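(* Let $\mathcal{A},\mathcal{B}\in\mathbb{R}^{n\times n\times n_3}$ with $\mathcal{A},\mathcal{B}\ge0$ be a commuting pair, i.e. $\mathcal{A}*\mathcal{B}=\mathcal{B}*\mathcal{A}$, and suppose $\mathcal{A}*\mathcal{B}\ge0$. Then for all real $p,q>1$ with $1/p+1/q=1$, $$\mathcal{A}*\mathcal{B}\le\frac1p\mathcal{A}^p+\frac1q\mathcal{B}^q.$$
   Context: For $\mathcal{A}\in\mathbb{R}^{n_1\times n_2\times n_3}$ with frontal slices $A^{(1)},\dots,A^{(n_3)}$ (each $n_1\times n_2$), $\mathrm{bcirc}(\mathcal{A})$ is the $n_1n_3\times n_2n_3$ block circulant matrix whose first block column is $A^{(1)},A^{(2)},\dots,A^{(n_3)}$ (top to bottom), i.e. its $(i,j)$ block is $A^{(((i-j)\bmod n_3)+1)}$. $\mathrm{unfold}(\mathcal{A})$ is the first block column of $\mathrm{bcirc}(\mathcal{A})$ and $\mathrm{fold}$ is its inverse. The t-product of $\mathcal{A}\in\mathbb{R}^{n_1\times n_2\times n_3}$ and $\mathcal{B}\in\mathbb{R}^{n_2\times n_4\times n_3}$ is $\mathcal{A}*\mathcal{B}=\mathrm{fold}(\mathrm{bcirc}(\mathcal{A})\cdot\mathrm{unfold}(\mathcal{B}))\in\mathbb{R}^{n_1\times n_4\times n_3}$. The transpose $\mathcal{A}^{T}$ is obtained by transposing each frontal slice and reversing the order of the transposed slices $2,\dots,n_3$; $\mathcal{A}$ is symmetric if $\mathcal{A}^T=\mathcal{A}$. The inner product is $\langle\mathcal{X},\mathcal{Y}\rangle=\sum_{i,j,k}x_{ijk}y_{ijk}$.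 A tensor $\mathcal{A}\in\mathbb{R}^{n\times n\times n_3}$ is symmetric t-positive semidefinite, written $\mathcal{A}\ge0$, if it is symmetric and $\langle\mathcal{X},\mathcal{A}*\mathcal{X}\rangle\ge0$ for all nonzero $\mathcal{X}\in\mathbb{R}^{n\times1\times n_3}$. For symmetric tensors, $\mathcal{A}\ge\mathcal{B}$ (equivalently $\mathcal{B}\le\mathcal{A}$) means $\mathcal{A}-\mathcal{B}\ge0$. For $\mathcal{A}\ge0$ and a real number $r>0$, the power $\mathcal{A}^r$ (a tensor t-function) is the tensor with $\mathrm{bcirc}(\mathcal{A}^r)=(\mathrm{bcirc}(\mathcal{A}))^r$, the usual power of a positive semidefinite matrix. *)

theory Defs
  imports Complex_Main "Jordan_Normal_Form.Matrix"
begin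

text \<open>
  A third-order tensor is the list of its frontal slices. Lists and matrices are indexed from 0,
  so \<open>A ! k\<close> is the slice usually written \<open>A\<^sup>(\<^sup>k\<^sup>+\<^sup>1\<^sup>)\<close>.
  All operations are meaningful for tensors with at least one slice.
\<close>

type_synonym tensor = "real mat list"

definition tensors :: "nat \<Rightarrow> nat \<Rightarrow> nat \<Rightarrow> tensor set" where
  "tensors n1 n2 n3 = {A. length A = n3 \<and> set A \<subseteq> carrier_mat n1 n2}"

definition tzero :: "nat \<Rightarrow> nat \<Rightarrow> nat \<Rightarrow> tensor" where
  "tzero n1 n2 n3 = replicate n3 (0\<^sub>m n1 n2)"

definition tplus :: "tensor \<Rightarrow> tensor \<Rightarrow> tensor" where
  "tplus A B = map2 (+) A B"

definition tminus :: "tensor \<Rightarrow> tensor \<Rightarrow> tensor" where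
  "tminus A B = map2 (-) A B"

definition tscale :: "real \<Rightarrow> tensor \<Rightarrow> tensor" where
  "tscale c A = map (\<lambda>S. c \<cdot>\<^sub>m S) A"

text \<open>
  Row \<open>i\<close> of the block matrix is row \<open>i mod n1\<close> of block row \<open>i div n1\<close>, and likewise for columns.
  Adding \<open>n3\<close> before subtracting avoids truncated subtraction; as \<open>j div n2 < n3\<close>, the slice
  index is the block row minus the block column modulo \<open>n3\<close>.
\<close>

definition bcirc :: "tensor \<Rightarrow> real mat" where
  "bcirc A = (let n1 = dim_row (hd A); n2 = dim_col (hd A); n3 = length A in
     mat (n1 * n3) (n2 * n3)
       (\<lambda>(i, j). (A ! ((i div n1 + n3 - j div n2) mod n3)) $$ (i mod n1, j mod n2)))"

definition tunfold :: "tensor \<Rightarrow> real mat" where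
  "tunfold A = mat (dim_row (hd A) * length A) (dim_col (hd A)) (\<lambda>(i, j). bcirc A $$ (i, j))"

definition tfold :: "nat \<Rightarrow> real mat \<Rightarrow> tensor" where
  "tfold n3 M = (let n1 = dim_row M div n3 in
     map (\<lambda>k. mat n1 (dim_col M) (\<lambda>(i, j). M $$ (k * n1 + i, j))) [0..<n3])"

lemma tfold_tunfold:
  assumes A: "A \<in> tensors n1 n2 n3" and n3: "0 < n3"
  shows "tfold n3 (tunfold A) = A"
proof -
  have len: "length A = n3" and car: "\<And>k. k < n3 \<Longrightarrow> A ! k \<in> carrier_mat n1 n2"
    using A by (auto simp: tensors_def)
  have hd: "hd A = A ! 0"
    using len n3 by (metis hd_conv_nth length_0_conv less_irrefl)
  have dims: "dim_row (hd A) = n1" "dim_col (hd A) = n2"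
    using car[OF n3] by (auto simp: hd)
  show ?thesis
  proof (rule nth_equalityI)
    show "length (tfold n3 (tunfold A)) = length A"
      by (simp add: tfold_def Let_def len)
  next
    fix k assume "k < length (tfold n3 (tunfold A))"
    then have k: "k < n3"
      by (simp add: tfold_def Let_def)
    have bound: "k * n1 + i < n1 * n3" if "i < n1" for i
    proof -
      have "k * n1 + i < Suc k * n1"
        using that by simp
      also have "\<dots> \<le> n3 * n1"
        using k by (intro mult_right_mono) auto
      finally show ?thesis
        by (simp add: mult.commute)
    qed
    have col: "j < n2 * n3" if "j < n2" for j
      using that n3 by (metis less_le_trans mult.right_neutral mult_le_mono2 Suc_leI One_nat_def)
    show "tfold n3 (tunfold A) ! k = A ! k"
      using car[OF k] k n3
      by (intro eq_matI)
        (auto simp: tfold_def tunfold_def bcirc_def Let_def len dims bound col)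
  qed
qed

definition tprod :: "tensor \<Rightarrow> tensor \<Rightarrow> tensor" where
  "tprod A B = tfold (length A) (bcirc A * tunfold B)"

definition ttranspose :: "tensor \<Rightarrow> tensor" where
  "ttranspose A = transpose_mat (hd A) # rev (map transpose_mat (tl A))"

definition tsymmetric :: "tensor \<Rightarrow> bool" where
  "tsymmetric A \<longleftrightarrow> ttranspose A = A"

definition tinner :: "tensor \<Rightarrow> tensor \<Rightarrow> real" where
  "tinner X Y = (\<Sum>k<length X. \<Sum>i<dim_row (X ! k). \<Sum>j<dim_col (X ! k).
     (X ! k) $$ (i, j) * (Y ! k) $$ (i, j))"

definition tpsd :: "nat \<Rightarrow> nat \<Rightarrow> tensor \<Rightarrow> bool" where
  "tpsd n n3 A \<longleftrightarrow> A \<in> tensors n n n3 \<and> tsymmetric A \<and>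
     (\<forall>X \<in> tensors n 1 n3. X \<noteq> tzero n 1 n3 \<longrightarrow> tinner X (tprod A X) \<ge> 0)"

definition tle :: "nat \<Rightarrow> nat \<Rightarrow> tensor \<Rightarrow> tensor \<Rightarrow> bool" where
  "tle n n3 B A \<longleftrightarrow> A \<in> tensors n n n3 \<and> B \<in> tensors n n n3 \<and>
     tsymmetric A \<and> tsymmetric B \<and> tpsd n n3 (tminus A B)"

text \<open>
  The real power of a positive semidefinite matrix by the spectral calculus: if
  \<open>M = U diag(d) U\<^sup>T\<close> with \<open>U\<close> orthogonal and \<open>d \<ge> 0\<close>, then \<open>M\<^sup>r = U diag(d\<^sup>r) U\<^sup>T\<close>, which does
  not depend on the chosen decomposition. For \<open>r > 0\<close> the convention \<open>0 powr r = 0\<close> is the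
  right one.
\<close>

definition is_psd_power :: "real mat \<Rightarrow> real \<Rightarrow> real mat \<Rightarrow> bool" where
  "is_psd_power M r P \<longleftrightarrow> (let N = dim_row M in
     \<exists>U \<in> carrier_mat N N. \<exists>d :: nat \<Rightarrow> real.
       U * transpose_mat U = 1\<^sub>m N \<and> (\<forall>i<N. d i \<ge> 0) \<and>
       M = U * mat_diag N d * transpose_mat U \<and>
       P = U * mat_diag N (\<lambda>i. d i powr r) * transpose_mat U)"

definition psd_power :: "real mat \<Rightarrow> real \<Rightarrow> real mat" where
  "psd_power M r = (THE P. is_psd_power M r P)"

definition tpower :: "tensor \<Rightarrow> real \<Rightarrow> tensor" where
  "tpower A r = (THE T. T \<in> tensors (dim_row (hd A)) (dim_col (hd A)) (length A) \<and>
     bcirc T = psd_power (bcirc A) r)"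

end

theory Submission
  imports Defs "Jordan_Normal_Form.Spectral_Radius" "HOL-Analysis.Convex"
begin

text \<open>
  The block circulant matrix of a tensor turns the t-product into the matrix product, the tensor
  transpose into the matrix transpose, and \<open>\<langle>X, A * X\<rangle>\<close> into the quadratic form of \<open>bcirc A\<close>
  (\<open>bcirc_tprod\<close>, \<open>bcirc_ttranspose\<close>, \<open>tpsd_iff\<close>). So the claim becomes a statement about two
  commuting positive semidefinite matrices \<open>M\<close> and \<open>N\<close>: the matrix \<open>M\<^sup>p / p + N\<^sup>q / q - M N\<close> is
  positive semidefinite. On a common eigenvector with eigenvalues \<open>a, b \<ge> 0\<close> this is Young's
  inequality \<open>a b \<le> a\<^sup>p / p + b\<^sup>q / q\<close>.

  The matrix inequality (\<open>commuting_product_bound\<close>) is derived without a simultaneous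
  diagonalisation. Let \<open>M = U diag(d) U\<^sup>T\<close> and \<open>N = V diag(e) V\<^sup>T\<close> be two independent spectral
  decompositions, and let \<open>W = U\<^sup>T V\<close> compare the two eigenbases. Every function of \<open>N\<close> commutes
  with \<open>M\<close>, so the matrix of \<open>\<phi>(N)\<close> in the basis \<open>U\<close> has no entries between different
  eigenvalues \<open>d i \<noteq> d k\<close>. Hence, whenever \<open>f(a) + g(b) - a b\<close> has a nonnegative value \<open>r(a, b)\<^sup>2\<close>
  at all pairs of eigenvalues, the matrix of \<open>f(M) + g(N) - M N\<close> in the basis \<open>U\<close> is \<open>K K\<^sup>T\<close> with
  \<open>K i j = r (d i) (e j) W i j\<close>.

  Two facts about spectral decompositions support this. They exist for every real symmetric matrix
  (\<open>real_spectral_theorem\<close>). And a matrix that intertwines \<open>M\<close> with \<open>N\<close> intertwines \<open>f(M)\<close> with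
  \<open>f(N)\<close> (\<open>spectral_mat_intertwine\<close>). The latter yields both that a function of a matrix does not
  depend on the decomposition and that it commutes with all that the matrix commutes with.

  Finally, powers of tensors have to exist, that is, a power of a block circulant matrix has to be
  block circulant. A matrix is block circulant iff it is invariant under the cyclic shift of its
  block rows and block columns. Shifting the rows of \<open>U\<close> gives another spectral decomposition
  of a block circulant matrix, and by independence of the decomposition the function of the matrix
  is invariant as well (\<open>circulant_blocks_spectral_mat\<close>).
\<close>

section \<open>The spectral theorem for real symmetric matrices\<close>

text \<open>
  A complex eigenvector \<open>a + i b\<close> exists. Symmetry forces its eigenvalue to be real, and then
  \<open>a\<close> or \<open>b\<close>, whichever is nonzero, is a real eigenvector.
\<close>

lemma real_symmetric_eigenvector:
  fixes M :: "real mat"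
  assumes M: "M \<in> carrier_mat n n" and sym: "transpose_mat M = M" and n: "0 < n"
  obtains v k where "v \<in> carrier_vec n" "scalar_prod v v = 1" "M *\<^sub>v v = k \<cdot>\<^sub>v v"
proof -
  let ?C = "map_mat complex_of_real M"
  have C: "?C \<in> carrier_mat n n" using M by auto
  obtain z w where "eigenvector ?C w z"
    using spectrum_non_empty[OF C n] by (auto simp: spectrum_def eigenvalue_def)
  then have w: "w \<in> carrier_vec n" "w \<noteq> 0\<^sub>v n" and Cw: "?C *\<^sub>v w = z \<cdot>\<^sub>v w"
    using M by (auto simp: eigenvector_def)
  define a where "a i = Re (w $ i)" for i
  define b where "b i = Im (w $ i)" for i
  have row: "(\<Sum>j<n. complex_of_real (M $$ (i, j)) * w $ j) = z * w $ i" if "i < n" for i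
    using arg_cong[OF Cw, of "\<lambda>u. u $ i"] that w(1) M
    by (simp add: scalar_prod_def atLeast0LessThan)
  have Ma: "(\<Sum>j<n. M $$ (i, j) * a j) = Re z * a i - Im z * b i" if "i < n" for i
    using arg_cong[OF row[OF that], of Re] by (simp add: a_def b_def)
  have Mb: "(\<Sum>j<n. M $$ (i, j) * b j) = Re z * b i + Im z * a i" if "i < n" for i
    using arg_cong[OF row[OF that], of Im] by (simp add: a_def b_def)
  have M_sym: "M $$ (i, j) = M $$ (j, i)" if "i < n" "j < n" for i j
    using arg_cong[OF sym, of "\<lambda>A. A $$ (i, j)"] that M by simp
  \<comment> \<open>Both sides of \<open>b \<bullet> M a = a \<bullet> M b\<close> are expanded by the eigenvalue equation; the difference
    is the imaginary part of the eigenvalue times the squared norm of the eigenvector.\<close>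
  have "(\<Sum>i<n. b i * (Re z * a i - Im z * b i)) = (\<Sum>i<n. b i * (\<Sum>j<n. M $$ (i, j) * a j))"
    by (intro sum.cong) (simp_all add: Ma)
  also have "\<dots> = (\<Sum>i<n. \<Sum>j<n. b i * M $$ (i, j) * a j)"
    by (simp add: sum_distrib_left mult.assoc)
  also have "\<dots> = (\<Sum>j<n. \<Sum>i<n. b i * M $$ (i, j) * a j)"
    by (rule sum.swap)
  also have "\<dots> = (\<Sum>j<n. a j * (\<Sum>i<n. M $$ (j, i) * b i))"
    unfolding sum_distrib_left by (intro sum.cong refl) (simp add: M_sym mult_ac)
  also have "\<dots> = (\<Sum>i<n. a i * (Re z * b i + Im z * a i))"
    by (intro sum.cong) (simp_all add: Mb)
  finally have "(\<Sum>i<n. b i * (Re z * a i - Im z * b i)) = (\<Sum>i<n. a i * (Re z * b i + Im z * a i))" .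
  then have "Im z * (\<Sum>i<n. (a i)\<^sup>2 + (b i)\<^sup>2) = 0"
    by (simp add: sum_subtractf sum.distrib algebra_simps power2_eq_square sum_distrib_left)
  moreover obtain m where m: "m < n" "w $ m \<noteq> 0"
    using w by (metis carrier_vecD eq_vecI index_zero_vec)
  have "(\<Sum>i<n. (a i)\<^sup>2 + (b i)\<^sup>2) > 0"
  proof (rule sum_pos2)
    show "0 < (a m)\<^sup>2 + (b m)\<^sup>2"
      using m(2) by (simp add: a_def b_def complex_eq_iff sum_power2_gt_zero_iff)
  qed (use m in auto)
  ultimately have z: "Im z = 0" by simp
  obtain c where c: "c m \<noteq> 0" "\<And>i. i < n \<Longrightarrow> (\<Sum>j<n. M $$ (i, j) * c j) = Re z * c i"
  proof (cases "a m = 0")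
    case True
    then have "b m \<noteq> 0" using m(2) by (simp add: a_def b_def complex_eq_iff)
    then show ?thesis using that[of b] Mb z by simp
  next
    case False
    then show ?thesis using that[of a] Ma z by simp
  qed
  define s where "s = (\<Sum>i<n. (c i)\<^sup>2)"
  have s: "s > 0"
    unfolding s_def by (rule sum_pos2[of _ m]) (use m c in auto)
  show ?thesis
  proof (rule that[of "vec n (\<lambda>i. c i / sqrt s)" "Re z"])
    show "scalar_prod (vec n (\<lambda>i. c i / sqrt s)) (vec n (\<lambda>i. c i / sqrt s)) = 1"
      using s by (simp add: scalar_prod_def atLeast0LessThan flip: power2_eq_square
        sum_divide_distrib power_divide s_def) (simp add: power_divide s_def flip: sum_divide_distrib)
    show "M *\<^sub>v vec n (\<lambda>i. c i / sqrt s) = Re z \<cdot>\<^sub>v vec n (\<lambda>i. c i / sqrt s)"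
      using M by (intro eq_vecI)
        (auto simp: scalar_prod_def atLeast0LessThan c(2) simp flip: sum_divide_distrib)
  qed auto
qed

text \<open>
  The matrix is the Householder reflection that exchanges the first unit vector and \<open>v\<close>, that is,
  the reflection in the hyperplane orthogonal to their difference \<open>w\<close>. It does not make sense for
  \<open>w = 0\<close>, where the identity does the job.
\<close>

lemma orthogonal_matrix_with_first_column:
  fixes v :: "real vec"
  assumes v: "v \<in> carrier_vec n" and unit: "scalar_prod v v = 1" and n: "0 < n"
  obtains H where "H \<in> carrier_mat n n" "H * transpose_mat H = 1\<^sub>m n" "col H 0 = v"
proof (cases "v = unit_vec n 0")
  case True
  show ?thesis
    by (rule that[of "1\<^sub>m n"]) (use True n in auto)
next
  case False
  define w where "w i = v $ i - (if i = 0 then 1 else 0)" for i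
  define \<delta> :: "nat \<Rightarrow> nat \<Rightarrow> real" where "\<delta> i j = (if i = j then 1 else 0)" for i j
  have vv: "(\<Sum>i<n. v $ i * v $ i) = 1"
    using unit v by (simp add: scalar_prod_def atLeast0LessThan)
  have "(\<Sum>i<n. w i * w i) = (\<Sum>i<n. v $ i * v $ i + (if i = 0 then 1 - 2 * v $ i else 0))"
    by (rule sum.cong) (auto simp: w_def algebra_simps)
  also have "\<dots> = 2 - 2 * v $ 0"
    using n by (simp add: sum.distrib vv sum.delta)
  finally have ww: "(\<Sum>i<n. w i * w i) = 2 - 2 * v $ 0" .
  have "\<exists>m<n. w m \<noteq> 0"
  proof (rule ccontr)
    assume "\<not> (\<exists>m<n. w m \<noteq> 0)"
    then have "v = unit_vec n 0" using v by (intro eq_vecI) (auto simp: w_def)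
    then show False using False by simp
  qed
  then obtain m where m: "m < n" "w m \<noteq> 0" by blast
  have "(\<Sum>i<n. w i * w i) > 0"
    by (rule sum_pos2[of _ m]) (use m in \<open>auto simp: not_square_less_zero zero_less_mult_iff\<close>)
  then have v0: "1 - v $ 0 > 0" by (simp add: ww)
  \<comment> \<open>The factor \<open>2 / (w \<bullet> w)\<close> of a reflection.\<close>
  define c where "c = 1 / (1 - v $ 0)"
  have c: "c * (\<Sum>i<n. w i * w i) = 2" using v0 by (simp add: c_def ww field_simps)
  define H where "H = mat n n (\<lambda>(i, j). \<delta> i j - c * (w i * w j))"
  show ?thesis
  proof (rule that[of H])
    show "H * transpose_mat H = 1\<^sub>m n"
    proof (rule eq_matI)
      fix i j assume ij: "i < dim_row (1\<^sub>m n :: real mat)" "j < dim_col (1\<^sub>m n :: real mat)"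
      then have ij: "i < n" "j < n" by auto
      have "(H * transpose_mat H) $$ (i, j) =
        (\<Sum>k<n. (\<delta> i k - c * (w i * w k)) * (\<delta> j k - c * (w j * w k)))"
        using ij by (simp add: H_def scalar_prod_def atLeast0LessThan)
      also have "\<dots> = (\<Sum>k<n. (if k = i then \<delta> j k - c * (w j * w k) else 0)
          - (if k = j then c * (w i * w k) else 0) + c * (w i * w j) * (c * (w k * w k)))"
        by (rule sum.cong) (auto simp: \<delta>_def algebra_simps)
      also have "\<dots> = \<delta> j i - c * (w j * w i) - c * (w i * w j)
          + c * (w i * w j) * (c * (\<Sum>k<n. w k * w k))"
        using ij by (simp add: sum.distrib sum_subtractf sum_distrib_left)
      also have "\<dots> = \<delta> i j" by (simp add: c \<delta>_def)
      finally show "(H * transpose_mat H) $$ (i, j) = 1\<^sub>m n $$ (i, j)"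
        using ij by (simp add: \<delta>_def)
    qed (auto simp: H_def)
    have "c * (w i * w 0) = - w i" for i
      using v0 by (simp add: c_def w_def field_simps)
    then show "col H 0 = v"
      using v n by (intro eq_vecI) (auto simp: H_def \<delta>_def w_def)
  qed (simp add: H_def)
qed

text \<open>
  Deflation: in an orthonormal basis that starts with an eigenvector, the first column of the
  matrix vanishes below the diagonal, and by symmetry so does the first row to its right. The
  remaining block is symmetric and one dimension smaller.
\<close>

theorem real_spectral_theorem:
  fixes M :: "real mat"
  assumes "M \<in> carrier_mat n n" and "transpose_mat M = M"
  shows "\<exists>U \<in> carrier_mat n n. \<exists>d. U * transpose_mat U = 1\<^sub>m n \<and>
    M = U * mat_diag n d * transpose_mat U"
  using assms
proof (induction n arbitrary: M)
  case 0
  then show ?case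
    by (intro bexI[of _ "1\<^sub>m 0"] exI[of _ "\<lambda>_. 0"]) auto
next
  case (Suc m)
  let ?n = "Suc m"
  note M = Suc.prems(1) and sym = Suc.prems(2)
  obtain v k where v: "v \<in> carrier_vec ?n" "scalar_prod v v = 1" and Mv: "M *\<^sub>v v = k \<cdot>\<^sub>v v"
    using real_symmetric_eigenvector[OF M sym] by blast
  obtain H where H: "H \<in> carrier_mat ?n ?n" and HH: "H * transpose_mat H = 1\<^sub>m ?n"
    and H0: "col H 0 = v"
    using orthogonal_matrix_with_first_column[OF v] by blast
  have Ht: "transpose_mat H \<in> carrier_mat ?n ?n" using H by simp
  have HtH: "transpose_mat H * H = 1\<^sub>m ?n"
    using mat_mult_left_right_inverse[OF H Ht HH] .
  define B where "B = transpose_mat H * (M * H)"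
  have B: "B \<in> carrier_mat ?n ?n" using H M by (auto simp: B_def)
  have "transpose_mat B = transpose_mat (M * H) * H"
    using H M by (simp add: B_def transpose_mult[of _ ?n ?n _ ?n])
  also have "\<dots> = B"
    using H M by (simp add: B_def transpose_mult[of _ ?n ?n _ ?n] sym assoc_mult_mat[of _ ?n ?n _ ?n _ ?n])
  finally have Bsym: "transpose_mat B = B" .
  have "col B 0 = transpose_mat H *\<^sub>v (M *\<^sub>v v)"
    using col_mult2[OF Ht mult_carrier_mat[OF M H], of 0] col_mult2[OF M H, of 0] H0
    by (simp add: B_def)
  also have "\<dots> = k \<cdot>\<^sub>v (transpose_mat H *\<^sub>v col H 0)"
    using Ht v H0 by (simp add: Mv mult_mat_vec[of _ ?n ?n])
  also have "transpose_mat H *\<^sub>v col H 0 = col (transpose_mat H * H) 0"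
    using col_mult2[OF Ht H, of 0] by simp
  finally have B0: "col B 0 = k \<cdot>\<^sub>v unit_vec ?n 0" by (simp add: HtH)
  have Bi0: "B $$ (i, 0) = (if i = 0 then k else 0)" if "i < ?n" for i
    using arg_cong[OF B0, of "\<lambda>u. u $ i"] that B by simp
  have B0i: "B $$ (0, i) = (if i = 0 then k else 0)" if "i < ?n" for i
    using arg_cong[OF Bsym, of "\<lambda>A. A $$ (i, 0)"] that B Bi0[OF that] by simp
  define B' where "B' = mat m m (\<lambda>(i, j). B $$ (Suc i, Suc j))"
  have B': "B' \<in> carrier_mat m m" by (simp add: B'_def)
  have "transpose_mat B' = B'"
  proof (rule eq_matI)
    fix i j assume "i < dim_row B'" "j < dim_col B'"
    then show "transpose_mat B' $$ (i, j) = B' $$ (i, j)"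
      using arg_cong[OF Bsym, of "\<lambda>A. A $$ (Suc i, Suc j)"] B by (simp add: B'_def)
  qed (auto simp: B'_def)
  then obtain V d where V: "V \<in> carrier_mat m m" and VV: "V * transpose_mat V = 1\<^sub>m m"
    and B'_eq: "B' = V * mat_diag m d * transpose_mat V"
    using Suc.IH[OF B'] by blast
  define F where "F = four_block_mat (1\<^sub>m 1) (0\<^sub>m 1 m) (0\<^sub>m m 1) V"
  define D where "D = mat_diag ?n (case_nat k d)"
  have F: "F \<in> carrier_mat ?n ?n"
    using four_block_carrier_mat[of "1\<^sub>m 1" 1 1 V m m] V by (simp add: F_def)
  have D: "D \<in> carrier_mat ?n ?n" by (simp add: D_def)
  have Ft: "transpose_mat F = four_block_mat (1\<^sub>m 1) (0\<^sub>m 1 m) (0\<^sub>m m 1) (transpose_mat V)"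
    unfolding F_def using V by (subst transpose_four_block_mat[of _ 1 1 _ m _ m]) auto
  have FF: "F * transpose_mat F = 1\<^sub>m ?n"
    unfolding Ft unfolding F_def using V VV
    by (subst mult_four_block_mat[of _ 1 1 _ m _ m _ _ 1 _ m]) (auto)
  have D_block: "D = four_block_mat (k \<cdot>\<^sub>m 1\<^sub>m 1) (0\<^sub>m 1 m) (0\<^sub>m m 1) (mat_diag m d)"
    by (rule eq_matI) (auto simp: D_def mat_diag_def less_Suc_eq_0_disj split: nat.splits)
  have FD: "F * D = four_block_mat (k \<cdot>\<^sub>m 1\<^sub>m 1) (0\<^sub>m 1 m) (0\<^sub>m m 1) (V * mat_diag m d)"
    unfolding D_block F_def using V
    by (subst mult_four_block_mat[of _ 1 1 _ m _ m _ _ 1 _ m])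
      (auto simp: left_mult_zero_mat[of _ m m])
  have "F * D * transpose_mat F = four_block_mat (k \<cdot>\<^sub>m 1\<^sub>m 1) (0\<^sub>m 1 m) (0\<^sub>m m 1) B'"
    unfolding FD Ft B'_eq using V
    by (subst mult_four_block_mat[of _ 1 1 _ m _ m _ _ 1 _ m])
      (auto simp: mult_carrier_mat[of _ m m _ m] left_mult_zero_mat[of _ m m]
        right_mult_zero_mat[of _ m m])
  also have "\<dots> = B"
    by (rule eq_matI) (use B in \<open>auto simp: B'_def Bi0 B0i less_Suc_eq_0_disj\<close>)
  finally have B_eq: "F * D * transpose_mat F = B" .
  have U: "H * F \<in> carrier_mat ?n ?n" using H F by simp
  have UU: "(H * F) * transpose_mat (H * F) = 1\<^sub>m ?n"
  proof -
    have "(H * F) * transpose_mat (H * F) = H * (F * transpose_mat F) * transpose_mat H"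
      using H F by (simp add: transpose_mult[of _ ?n ?n _ ?n] assoc_mult_mat[of _ ?n ?n _ ?n _ ?n])
    then show ?thesis using H HH by (simp add: FF)
  qed
  have "(H * F) * D * transpose_mat (H * F) = H * (F * D * transpose_mat F) * transpose_mat H"
    using H F D by (simp add: transpose_mult[of _ ?n ?n _ ?n] assoc_mult_mat[of _ ?n ?n _ ?n _ ?n])
  also have "\<dots> = (H * transpose_mat H) * M * (H * transpose_mat H)"
    unfolding B_eq B_def using H M by (simp add: assoc_mult_mat[of _ ?n ?n _ ?n _ ?n])
  finally have "M = (H * F) * D * transpose_mat (H * F)" using M by (simp add: HH)
  then show ?case using U UU unfolding D_def by blast
qed

section \<open>Functions of a symmetric matrix\<close>

definition spectral_mat :: "nat \<Rightarrow> real mat \<Rightarrow> (nat \<Rightarrow> real) \<Rightarrow> real mat" where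
  "spectral_mat n U d = U * mat_diag n d * transpose_mat U"

lemma spectral_mat_carrier [simp]:
  "U \<in> carrier_mat n n \<Longrightarrow> spectral_mat n U d \<in> carrier_mat n n"
  by (simp add: spectral_mat_def mult_carrier_mat[of _ n n _ n])

lemma spectral_mat_entry:
  assumes "U \<in> carrier_mat n n" and "i < n" and "j < n"
  shows "spectral_mat n U d $$ (i, j) = (\<Sum>k<n. U $$ (i, k) * d k * U $$ (j, k))"
  using assms by (simp add: spectral_mat_def mat_diag_mult_right[of _ n n] scalar_prod_def
      atLeast0LessThan)

lemma transpose_spectral_mat:
  assumes "U \<in> carrier_mat n n"
  shows "transpose_mat (spectral_mat n U d) = spectral_mat n U d"
proof (rule eq_matI)
  fix i j assume "i < dim_row (spectral_mat n U d)" "j < dim_col (spectral_mat n U d)"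
  then have "i < n" "j < n" using assms by (auto simp: spectral_mat_def)
  then show "transpose_mat (spectral_mat n U d) $$ (i, j) = spectral_mat n U d $$ (i, j)"
    using assms carrier_matD[OF spectral_mat_carrier[OF assms, of d]]
    by (simp add: spectral_mat_entry mult_ac)
qed (use assms in \<open>auto simp: spectral_mat_def\<close>)

lemma smult_spectral_mat:
  assumes "U \<in> carrier_mat n n"
  shows "c \<cdot>\<^sub>m spectral_mat n U d = spectral_mat n U (\<lambda>i. c * d i)"
proof (rule eq_matI)
  note dims = carrier_matD[OF spectral_mat_carrier[OF assms]]
  fix i j assume "i < dim_row (spectral_mat n U (\<lambda>i. c * d i))"
    "j < dim_col (spectral_mat n U (\<lambda>i. c * d i))"
  then have "i < n" "j < n" by (simp_all add: dims)
  then show "(c \<cdot>\<^sub>m spectral_mat n U d) $$ (i, j) = spectral_mat n U (\<lambda>i. c * d i) $$ (i, j)"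
    by (simp add: dims spectral_mat_entry[OF assms] sum_distrib_left mult_ac)
qed (simp_all add: carrier_matD[OF spectral_mat_carrier[OF assms]])

lemma orthogonal_transpose_mult:
  fixes U :: "real mat"
  assumes "U \<in> carrier_mat n n" and "U * transpose_mat U = 1\<^sub>m n"
  shows "transpose_mat U * U = 1\<^sub>m n"
  using mat_mult_left_right_inverse[of U n "transpose_mat U"] assms by simp

lemma orthogonal_cancel:
  fixes U :: "real mat"
  assumes "U \<in> carrier_mat n n" and "U * transpose_mat U = 1\<^sub>m n" and "X \<in> carrier_mat n n"
  shows "U * (transpose_mat U * X) = X" and "transpose_mat U * (U * X) = X"
  using assms orthogonal_transpose_mult[OF assms(1,2)]
  by (simp_all flip: assoc_mult_mat[of _ n n _ n _ n])

text \<open>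
  In the two eigenbases the hypothesis reads \<open>W i j * d j = e i * W i j\<close>, where \<open>W = V\<^sup>T X U\<close>. So
  wherever \<open>W i j\<close> is nonzero, \<open>d j = e i\<close> and hence \<open>f (d j) = f (e i)\<close>.
\<close>

lemma spectral_mat_intertwine:
  assumes U: "U \<in> carrier_mat n n" "U * transpose_mat U = 1\<^sub>m n"
    and V: "V \<in> carrier_mat n n" "V * transpose_mat V = 1\<^sub>m n"
    and X: "X \<in> carrier_mat n n"
    and eq: "X * spectral_mat n U d = spectral_mat n V e * X"
  shows "X * spectral_mat n U (\<lambda>i. f (d i)) = spectral_mat n V (\<lambda>i. f (e i)) * X"
proof -
  note [simp] = left_mult_one_mat[of _ n n] right_mult_one_mat[of _ n n]
    mult_carrier_mat[of _ n n _ n] assoc_mult_mat[of _ n n _ n _ n]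
    orthogonal_transpose_mult[OF U] orthogonal_transpose_mult[OF V]
    orthogonal_cancel[OF U] orthogonal_cancel[OF V]
  define W where "W = transpose_mat V * X * U"
  have W: "W \<in> carrier_mat n n" using U V X by (simp add: W_def)
  have "W * mat_diag n d = transpose_mat V * (X * spectral_mat n U d) * U"
    using U V X by (simp add: W_def spectral_mat_def)
  also have "\<dots> = mat_diag n e * W"
    unfolding eq using U V X by (simp add: W_def spectral_mat_def)
  finally have WD: "W * mat_diag n d = mat_diag n e * W" .
  have entry: "W $$ (i, j) * d j = e i * W $$ (i, j)" if "i < n" "j < n" for i j
    using arg_cong[OF WD, of "\<lambda>A. A $$ (i, j)"] that W
    by (simp add: mat_diag_mult_left[of _ n n] mat_diag_mult_right[of _ n n])
  have "W * mat_diag n (\<lambda>i. f (d i)) = mat_diag n (\<lambda>i. f (e i)) * W"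
  proof (rule eq_matI)
    fix i j assume "i < dim_row (mat_diag n (\<lambda>i. f (e i)) * W)"
      "j < dim_col (mat_diag n (\<lambda>i. f (e i)) * W)"
    then have ij: "i < n" "j < n" using W by (auto simp: mat_diag_def)
    have "W $$ (i, j) = 0 \<or> d j = e i"
      using entry[OF ij] by (simp add: mult.commute)
    then show "(W * mat_diag n (\<lambda>i. f (d i))) $$ (i, j) = (mat_diag n (\<lambda>i. f (e i)) * W) $$ (i, j)"
      using W ij by (auto simp: mat_diag_mult_left[of _ n n] mat_diag_mult_right[of _ n n])
  qed (use W in \<open>auto simp: mat_diag_def\<close>)
  then have "V * (W * mat_diag n (\<lambda>i. f (d i))) * transpose_mat U
      = V * (mat_diag n (\<lambda>i. f (e i)) * W) * transpose_mat U" by simp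
  then show ?thesis
    using U V X by (simp add: W_def spectral_mat_def)
qed

text \<open>
  The identity intertwines a matrix with itself, so the eigenbasis chosen does not matter for
  \<open>f(M)\<close>.
\<close>

lemma spectral_mat_unique:
  assumes "U \<in> carrier_mat n n" "U * transpose_mat U = 1\<^sub>m n"
    and "V \<in> carrier_mat n n" "V * transpose_mat V = 1\<^sub>m n"
    and "spectral_mat n U d = spectral_mat n V e"
  shows "spectral_mat n U (\<lambda>i. f (d i)) = spectral_mat n V (\<lambda>i. f (e i))"
  using spectral_mat_intertwine[of U n V "1\<^sub>m n" d e f] assms
  by (simp add: left_mult_one_mat[of _ n n] right_mult_one_mat[of _ n n])

lemma is_psd_power_spectral_mat:
  assumes "M \<in> carrier_mat n n"
  shows "is_psd_power M r P \<longleftrightarrow> (\<exists>U \<in> carrier_mat n n. \<exists>d.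
    U * transpose_mat U = 1\<^sub>m n \<and> (\<forall>i<n. 0 \<le> d i) \<and>
    M = spectral_mat n U d \<and> P = spectral_mat n U (\<lambda>i. d i powr r))"
  using assms by (simp add: is_psd_power_def spectral_mat_def Let_def)

lemma psd_power_spectral_mat:
  assumes U: "U \<in> carrier_mat n n" "U * transpose_mat U = 1\<^sub>m n"
    and d: "\<And>i. i < n \<Longrightarrow> 0 \<le> d i"
  shows "psd_power (spectral_mat n U d) r = spectral_mat n U (\<lambda>i. d i powr r)"
  unfolding psd_power_def
proof (rule the_equality)
  note M = spectral_mat_carrier[OF U(1), of d]
  show "is_psd_power (spectral_mat n U d) r (spectral_mat n U (\<lambda>i. d i powr r))"
    unfolding is_psd_power_spectral_mat[OF M] using U d by blast
  fix P assume "is_psd_power (spectral_mat n U d) r P"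
  then obtain V e where V: "V \<in> carrier_mat n n" "V * transpose_mat V = 1\<^sub>m n"
    and eq: "spectral_mat n U d = spectral_mat n V e"
    and P: "P = spectral_mat n V (\<lambda>i. e i powr r)"
    unfolding is_psd_power_spectral_mat[OF M] by blast
  show "P = spectral_mat n U (\<lambda>i. d i powr r)"
    unfolding P by (rule spectral_mat_unique[OF V U eq[symmetric]])
qed

text \<open>
  An eigenvalue is the value of the quadratic form at its unit eigenvector, a column of \<open>U\<close>.
\<close>

lemma psd_spectral_decomposition:
  fixes M :: "real mat"
  assumes M: "M \<in> carrier_mat n n" and sym: "transpose_mat M = M"
    and psd: "\<And>x. x \<in> carrier_vec n \<Longrightarrow> 0 \<le> scalar_prod x (M *\<^sub>v x)"
  obtains U d where "U \<in> carrier_mat n n" "U * transpose_mat U = 1\<^sub>m n"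
    "M = spectral_mat n U d" "\<And>i. i < n \<Longrightarrow> 0 \<le> d i"
proof -
  obtain U d where U: "U \<in> carrier_mat n n" "U * transpose_mat U = 1\<^sub>m n"
    and M_eq: "M = spectral_mat n U d"
    using real_spectral_theorem[OF M sym] by (auto simp: spectral_mat_def)
  have "0 \<le> d i" if i: "i < n" for i
  proof -
    have "M * U = U * mat_diag n d"
      unfolding M_eq spectral_mat_def using U orthogonal_transpose_mult[OF U]
      by (simp add: assoc_mult_mat[of _ n n _ n _ n] mult_carrier_mat[of _ n n _ n]
        right_mult_one_mat[of _ n n])
    then have "transpose_mat U * (M * U) = mat_diag n d"
      using orthogonal_cancel[OF U] by simp
    then have "d i = (transpose_mat U * (M * U)) $$ (i, i)"
      using i by (simp add: mat_diag_def)
    also have "\<dots> = scalar_prod (col U i) (col (M * U) i)"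
      using i U(1) M by simp
    also have "\<dots> = scalar_prod (col U i) (M *\<^sub>v col U i)"
      unfolding col_mult2[OF M U(1) i] ..
    also have "\<dots> \<ge> 0"
      using psd[of "col U i"] col_dim[of U i] unfolding carrier_matD[OF U(1)] by blast
    finally show ?thesis .
  qed
  then show ?thesis using that U M_eq by blast
qed

section \<open>A bound for the product of commuting symmetric matrices\<close>

lemma conjugate_add_minus:
  fixes A B C P Q :: "real mat"
  assumes c: "P \<in> carrier_mat n n" "Q \<in> carrier_mat n n" "A \<in> carrier_mat n n"
    "B \<in> carrier_mat n n" "C \<in> carrier_mat n n"
  shows "P * (A + B - C) * Q = P * A * Q + P * B * Q - P * C * Q"
proof -
  have "P * (A + B - C) = P * A + P * B - P * C"
    using c by (simp add: mult_minus_distrib_mat[of P n n _ n] mult_add_distrib_mat[of P n n _ n])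
  then show ?thesis
    using c by (simp add: minus_mult_distrib_mat[of _ n n _ Q n] add_mult_distrib_mat[of _ n n _ Q n]
      mult_carrier_mat[of _ n n _ n])
qed

text \<open>
  The matrix turns out to be of the form \<open>L L\<^sup>T\<close>. If \<open>U\<close> and \<open>V\<close> were the same basis, \<open>L\<close> could be
  \<open>U\<close> with its columns scaled by the square roots of \<open>f (d i) + g (e i) - d i * e i\<close>. In general
  the square root at the pair \<open>(d i, e j)\<close> weights the entry \<open>W i j\<close> of the change of basis.
\<close>

lemma commuting_product_bound:
  assumes U: "U \<in> carrier_mat n n" "U * transpose_mat U = 1\<^sub>m n"
    and V: "V \<in> carrier_mat n n" "V * transpose_mat V = 1\<^sub>m n"
    and comm: "spectral_mat n U d * spectral_mat n V e = spectral_mat n V e * spectral_mat n U d"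
    and bound: "\<And>i j. i < n \<Longrightarrow> j < n \<Longrightarrow> d i * e j \<le> f (d i) + g (e j)"
    and x: "x \<in> carrier_vec n"
  shows "0 \<le> scalar_prod x ((spectral_mat n U (\<lambda>i. f (d i)) + spectral_mat n V (\<lambda>i. g (e i))
    - spectral_mat n U d * spectral_mat n V e) *\<^sub>v x)"
proof -
  note [simp] = left_mult_one_mat[of _ n n] right_mult_one_mat[of _ n n]
    mult_carrier_mat[of _ n n _ n] assoc_mult_mat[of _ n n _ n _ n]
    orthogonal_transpose_mult[OF U] orthogonal_transpose_mult[OF V]
    orthogonal_cancel[OF U] orthogonal_cancel[OF V]
  let ?M = "spectral_mat n U d"
  define W where "W = transpose_mat U * V"
  have W: "W \<in> carrier_mat n n" using U V by (simp add: W_def)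
  have Wt: "transpose_mat W = transpose_mat V * U"
    using U V by (simp add: W_def transpose_mult[of _ n n _ n])
  have WW: "W * transpose_mat W = 1\<^sub>m n"
    unfolding Wt unfolding W_def using U V by simp
  have UW: "U * W = V" using U V by (simp add: W_def)
  \<comment> \<open>\<open>spectral_mat n W (\<lambda>j. \<phi> (e j))\<close> is the matrix of \<open>\<phi>(N)\<close> in the eigenbasis of \<open>M\<close>. It
    commutes with \<open>diag(d)\<close>, as \<open>\<phi>(N)\<close> commutes with \<open>M\<close>.\<close>
  have offdiag: "spectral_mat n W (\<lambda>j. \<phi> (e j)) $$ (i, k) = 0"
    if ik: "i < n" "k < n" and ne: "d i \<noteq> d k" for \<phi> i k
  proof -
    let ?N = "spectral_mat n V (\<lambda>j. \<phi> (e j))" and ?S = "spectral_mat n W (\<lambda>j. \<phi> (e j))"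
    have "?M * ?N = ?N * ?M"
      by (rule spectral_mat_intertwine[OF V V _ comm]) (use U in simp)
    then have "transpose_mat U * (?M * ?N) * U = transpose_mat U * (?N * ?M) * U" by simp
    then have "mat_diag n d * ?S = ?S * mat_diag n d"
      using U V W unfolding spectral_mat_def Wt by (simp add: W_def)
    then have "(mat_diag n d * ?S) $$ (i, k) = (?S * mat_diag n d) $$ (i, k)" by simp
    then have "d i * ?S $$ (i, k) = ?S $$ (i, k) * d k"
      using ik W by (simp add: mat_diag_mult_left[of _ n n] mat_diag_mult_right[of _ n n])
    then show ?thesis using ne by simp
  qed
  define K where "K = mat n n (\<lambda>(i, j). sqrt (f (d i) + g (e j) - d i * e j) * W $$ (i, j))"
  have K: "K \<in> carrier_mat n n" by (simp add: K_def)
  \<comment> \<open>The matrix of \<open>f(M) + g(N) - M N\<close> in the eigenbasis of \<open>M\<close>.\<close>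
  define T where "T = mat_diag n (\<lambda>i. f (d i)) + spectral_mat n W (\<lambda>j. g (e j))
    - mat_diag n d * spectral_mat n W e"
  have T: "T \<in> carrier_mat n n" using W by (simp add: T_def minus_carrier_mat)
  have "T = K * transpose_mat K"
  proof (rule eq_matI)
    fix i k assume "i < dim_row (K * transpose_mat K)" "k < dim_col (K * transpose_mat K)"
    then have ik: "i < n" "k < n" using K by auto
    let ?r = "\<lambda>i t. sqrt (f (d i) + g t - d i * t)"
    have KK: "(K * transpose_mat K) $$ (i, k) = spectral_mat n W (\<lambda>j. ?r i (e j) * ?r k (e j)) $$ (i, k)"
      using ik W by (simp add: K_def scalar_prod_def atLeast0LessThan spectral_mat_entry mult_ac)
    have Tik: "T $$ (i, k) = (if i = k then f (d i) else 0)
        + spectral_mat n W (\<lambda>j. g (e j)) $$ (i, k) - d i * spectral_mat n W e $$ (i, k)"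
      using ik carrier_matD[OF spectral_mat_carrier[OF W, of "\<lambda>j. g (e j)"]]
      unfolding T_def mat_diag_mult_left[OF spectral_mat_carrier[OF W]]
      by (simp add: mat_diag_def)
    \<comment> \<open>Entry \<open>(i, k)\<close> of \<open>K K\<^sup>T\<close> contains the mixed product \<open>r (d i) (e j) * r (d k) (e j)\<close>. It is
      the square of \<open>r (d i) (e j)\<close> if \<open>d i = d k\<close>; otherwise it is just some function of \<open>e j\<close>,
      whose contributions cancel by \<open>offdiag\<close>.\<close>
    show "T $$ (i, k) = (K * transpose_mat K) $$ (i, k)"
    proof (cases "d i = d k")
      case False
      then show ?thesis
        using ik offdiag[OF ik False, of "\<lambda>t. ?r i t * ?r k t"] offdiag[OF ik False, of g]
          offdiag[OF ik False, of "\<lambda>t. t"]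
        unfolding KK Tik by auto
    next
      case True
      have one: "(\<Sum>j<n. W $$ (i, j) * W $$ (k, j)) = (if i = k then 1 else 0)"
        using arg_cong[OF WW, of "\<lambda>A. A $$ (i, k)"] ik W
        by (simp add: scalar_prod_def atLeast0LessThan)
      have "(K * transpose_mat K) $$ (i, k)
          = (\<Sum>j<n. W $$ (i, j) * (f (d i) + g (e j) - d i * e j) * W $$ (k, j))"
        unfolding KK using ik W bound[of i] True
        by (simp add: spectral_mat_entry del: real_sqrt_mult flip: real_sqrt_mult)
      also have "\<dots> = f (d i) * (\<Sum>j<n. W $$ (i, j) * W $$ (k, j))
          + spectral_mat n W (\<lambda>j. g (e j)) $$ (i, k) - d i * spectral_mat n W e $$ (i, k)"
        using ik W by (simp add: spectral_mat_entry sum_distrib_left algebra_simps sum.distrib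
          sum_subtractf)
      finally show ?thesis unfolding Tik one by simp
    qed
  qed (use K T in auto)
  define L where "L = U * K"
  have L: "L \<in> carrier_mat n n" using U K by (simp add: L_def)
  have "L * transpose_mat L = U * (K * transpose_mat K) * transpose_mat U"
    using U K by (simp add: L_def transpose_mult[of _ n n _ n])
  also have "\<dots> = U * T * transpose_mat U"
    using \<open>T = K * transpose_mat K\<close> by simp
  also have "\<dots> = spectral_mat n U (\<lambda>i. f (d i)) + U * spectral_mat n W (\<lambda>i. g (e i)) * transpose_mat U
    - U * (mat_diag n d * spectral_mat n W e) * transpose_mat U"
    unfolding T_def spectral_mat_def[of n U]
    by (intro conjugate_add_minus[of _ n] mat_diag_dim spectral_mat_carrier mult_carrier_mat[of _ n n]
      transpose_carrier_mat[THEN iffD2] U(1) W)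
  also have "U * spectral_mat n W (\<lambda>i. g (e i)) * transpose_mat U = spectral_mat n V (\<lambda>i. g (e i))"
    unfolding spectral_mat_def Wt using U V by (simp add: W_def)
  also have "U * (mat_diag n d * spectral_mat n W e) * transpose_mat U = ?M * spectral_mat n V e"
    unfolding spectral_mat_def Wt using U V by (simp add: W_def)
  finally have LL: "spectral_mat n U (\<lambda>i. f (d i)) + spectral_mat n V (\<lambda>i. g (e i))
    - ?M * spectral_mat n V e = L * transpose_mat L" ..
  let ?y = "transpose_mat L *\<^sub>v x"
  have "scalar_prod x ((L * transpose_mat L) *\<^sub>v x) = scalar_prod x (L *\<^sub>v ?y)"
    using L x by simp
  also have "\<dots> = scalar_prod ?y ?y"
    using L x by (simp add: transpose_vec_mult_scalar[of L n n] )
  also have "\<dots> \<ge> 0"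
    by (simp add: scalar_prod_def sum_nonneg)
  finally show ?thesis unfolding LL .
qed

section \<open>Block circulant matrices and tensors\<close>

text \<open>
  Block circulance is expressed as invariance under the cyclic shift by one block of size \<open>n\<close>, with
  no reference to the blocks themselves. In this form it is seen to pass to products and to
  functions of a matrix.
\<close>

definition circulant_blocks :: "nat \<Rightarrow> nat \<Rightarrow> real mat \<Rightarrow> bool" where
  "circulant_blocks n n3 C \<longleftrightarrow> C \<in> carrier_mat (n * n3) (n * n3) \<and>
     (\<forall>i < n * n3. \<forall>j < n * n3.
        C $$ ((i + n) mod (n * n3), (j + n) mod (n * n3)) = C $$ (i, j))"

lemma tensorsD:
  assumes "A \<in> tensors n1 n2 n3"
  shows "length A = n3" and "k < n3 \<Longrightarrow> A ! k \<in> carrier_mat n1 n2"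
    and "0 < n3 \<Longrightarrow> dim_row (hd A) = n1" and "0 < n3 \<Longrightarrow> dim_col (hd A) = n2"
proof -
  show len: "length A = n3" and car: "k < n3 \<Longrightarrow> A ! k \<in> carrier_mat n1 n2" for k
    using assms by (auto simp: tensors_def)
  show "0 < n3 \<Longrightarrow> dim_row (hd A) = n1" and "0 < n3 \<Longrightarrow> dim_col (hd A) = n2"
    using len car[of 0] by (auto simp: hd_conv_nth)
qed

lemma tensorsI:
  assumes "length A = n3" and "\<And>k. k < n3 \<Longrightarrow> A ! k \<in> carrier_mat n1 n2"
  shows "A \<in> tensors n1 n2 n3"
  using assms by (fastforce simp: tensors_def in_set_conv_nth)

lemma bcirc_carrier:
  assumes "A \<in> tensors n1 n2 n3" and "0 < n3"
  shows "bcirc A \<in> carrier_mat (n1 * n3) (n2 * n3)"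
  using tensorsD[OF assms(1)] assms(2) by (simp add: bcirc_def Let_def)

lemma bcirc_entry:
  assumes "A \<in> tensors n1 n2 n3" and "0 < n3" and "i < n1 * n3" and "j < n2 * n3"
  shows "bcirc A $$ (i, j) = (A ! ((i div n1 + n3 - j div n2) mod n3)) $$ (i mod n1, j mod n2)"
  using tensorsD[OF assms(1)] assms(2-) by (simp add: bcirc_def Let_def)

lemma bcirc_inject:
  assumes "A \<in> tensors n1 n2 n3" and "B \<in> tensors n1 n2 n3" and "0 < n3" and "bcirc A = bcirc B"
  shows "A = B"
proof -
  have "tunfold A = tunfold B"
    using tensorsD[OF assms(1)] tensorsD[OF assms(2)] assms(3,4) by (simp add: tunfold_def)
  then show ?thesis
    using tfold_tunfold[OF assms(1,3)] tfold_tunfold[OF assms(2,3)] by metis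
qed

lemma tfold_tensors:
  assumes "M \<in> carrier_mat (n1 * n3) n2" and "0 < n3"
  shows "tfold n3 M \<in> tensors n1 n2 n3"
  using assms by (intro tensorsI) (auto simp: tfold_def Let_def)

lemma tfold_entry:
  assumes "M \<in> carrier_mat (n1 * n3) n2" and "k < n3" and "i < n1" and "j < n2"
  shows "(tfold n3 M ! k) $$ (i, j) = M $$ (k * n1 + i, j)"
  using assms by (auto simp: tfold_def Let_def)

lemma div_less_blocks: "(i :: nat) < n * n3 \<Longrightarrow> i div n < n3"
  by (simp add: less_mult_imp_div_less mult.commute)

lemma mod_less_block: "(i :: nat) < n * n3 \<Longrightarrow> i mod n < n"
  by (cases n) auto

lemma mod_add_diff:
  fixes a b m :: nat
  assumes "a < m" and "b < m"
  shows "(a + m - b) mod m = (if b \<le> a then a - b else a + m - b)"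
proof (cases "b \<le> a")
  case True
  then have "a + m - b = (a - b) + m" by simp
  then have "(a + m - b) mod m = (a - b) mod m" by (simp only: mod_add_self2)
  then show ?thesis using True assms by simp
qed (use assms in simp)

lemma mod_minus_diff:
  fixes a b m :: nat
  assumes "a < m" and "b < m"
  shows "(m - (a + m - b) mod m) mod m = (b + m - a) mod m"
proof -
  have "m - (a - b) < m" if "b < a" using that assms by simp
  moreover have "m - (a - b) = b + m - a" if "b < a" using that assms by simp
  moreover have "m - (a + m - b) = b - a" if "a < b" using that assms by simp
  ultimately show ?thesis
    unfolding mod_add_diff[OF assms] mod_add_diff[OF assms(2,1)]
    using assms by (cases a b rule: linorder_cases) (simp_all del: diff_diff_right)
qed

lemma circulant_blocks_bcirc:
  assumes A: "A \<in> tensors n n n3" and n3: "0 < n3"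
  shows "circulant_blocks n n3 (bcirc A)"
  unfolding circulant_blocks_def
proof (intro conjI allI impI)
  show "bcirc A \<in> carrier_mat (n * n3) (n * n3)" by (rule bcirc_carrier[OF A n3])
next
  fix i j assume i: "i < n * n3" and j: "j < n * n3"
  then have n: "0 < n" by (cases n) auto
  let ?s = "\<lambda>i. (i + n) mod (n * n3)"
  have div: "?s i div n = Suc (i div n) mod n3" and mod: "?s i mod n = i mod n" for i
    using n by (simp_all add: mod_mult2_eq)
  have less: "?s i < n * n3" for i using n n3 by simp
  have idx: "(Suc a mod n3 + n3 - Suc b mod n3) mod n3 = (a + n3 - b) mod n3"
    if "a < n3" "b < n3" for a b
  proof -
    have suc: "Suc c mod n3 = (if Suc c = n3 then 0 else Suc c)" if "c < n3" for c
      using that by auto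
    show ?thesis
      using that n3 unfolding suc[OF that(1)] suc[OF that(2)] by (auto simp: mod_add_diff)
  qed
  show "bcirc A $$ (?s i, ?s j) = bcirc A $$ (i, j)"
    using idx[OF div_less_blocks[OF i] div_less_blocks[OF j]]
    by (simp add: bcirc_entry[OF A n3] i j less div mod)
qed

lemma circulant_blocks_iterate:
  assumes "circulant_blocks n n3 C" and "i < n * n3" and "j < n * n3"
  shows "C $$ ((i + t * n) mod (n * n3), (j + t * n) mod (n * n3)) = C $$ (i, j)"
proof (induction t)
  case 0
  then show ?case using assms by simp
next
  case (Suc t)
  let ?i = "(i + t * n) mod (n * n3)" and ?j = "(j + t * n) mod (n * n3)"
  have "0 < n * n3" using assms(2) by linarith
  then have "?i < n * n3" "?j < n * n3" by simp_all
  then have "C $$ ((?i + n) mod (n * n3), (?j + n) mod (n * n3)) = C $$ (?i, ?j)"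
    using assms(1) unfolding circulant_blocks_def by blast
  moreover have "(?i + n) mod (n * n3) = (i + Suc t * n) mod (n * n3)"
    "(?j + n) mod (n * n3) = (j + Suc t * n) mod (n * n3)"
    unfolding mod_add_left_eq by (simp_all add: ac_simps)
  ultimately show ?case using Suc.IH by simp
qed

text \<open>
  Shifting by the \<open>n3 - j div n\<close> blocks that take block column \<open>j div n\<close> around to the first one.
  This is why a shift-invariant matrix is determined by its first block column.
\<close>

lemma circulant_blocks_first_column:
  assumes C: "circulant_blocks n n3 C" and i: "i < n * n3" and j: "j < n * n3"
  shows "C $$ (i, j) = C $$ (((i div n + n3 - j div n) mod n3) * n + i mod n, j mod n)"
proof -
  let ?t = "n3 - j div n"
  have n: "0 < n" using i by (cases n) auto
  have jd: "j div n < n3" using j by (rule div_less_blocks)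
  have "(i + ?t * n) div n = i div n + n3 - j div n" "(i + ?t * n) mod n = i mod n"
    using n jd by auto
  then have row: "(i + ?t * n) mod (n * n3) = ((i div n + n3 - j div n) mod n3) * n + i mod n"
    by (simp add: mod_mult2_eq mult.commute)
  have "(j + ?t * n) div n = n3" "(j + ?t * n) mod n = j mod n"
    using n jd by auto
  then have col: "(j + ?t * n) mod (n * n3) = j mod n"
    by (simp add: mod_mult2_eq)
  show ?thesis
    using circulant_blocks_iterate[OF C i j, of ?t] unfolding row col by simp
qed

lemma bcirc_tfold:
  assumes C: "circulant_blocks n n3 C" and n3: "0 < n3"
    and F: "F \<in> carrier_mat (n * n3) n"
    and eq: "\<And>i j. i < n * n3 \<Longrightarrow> j < n \<Longrightarrow> F $$ (i, j) = C $$ (i, j)"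
  shows "bcirc (tfold n3 F) = C"
proof (rule eq_matI)
  have T: "tfold n3 F \<in> tensors n n n3" by (rule tfold_tensors[OF F n3])
  have Cc: "C \<in> carrier_mat (n * n3) (n * n3)" using C by (simp add: circulant_blocks_def)
  show "dim_row (bcirc (tfold n3 F)) = dim_row C" "dim_col (bcirc (tfold n3 F)) = dim_col C"
    using Cc bcirc_carrier[OF T n3] by auto
  fix i j assume "i < dim_row C" "j < dim_col C"
  then have i: "i < n * n3" and j: "j < n * n3" using Cc by auto
  let ?k = "(i div n + n3 - j div n) mod n3"
  have r: "i mod n < n" "j mod n < n" using mod_less_block i j by blast+
  have "?k < n3" using n3 by simp
  then have "Suc ?k * n \<le> n3 * n" by (intro mult_right_mono) auto
  moreover have "?k * n + i mod n < Suc ?k * n" using r by simp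
  ultimately have less: "?k * n + i mod n < n * n3" by (simp only: mult.commute[of n n3])
  have "bcirc (tfold n3 F) $$ (i, j) = F $$ (?k * n + i mod n, j mod n)"
    using tfold_entry[OF F _ r, of ?k] n3 by (simp add: bcirc_entry[OF T n3 i j])
  also have "\<dots> = C $$ (i, j)"
    using eq[OF less r(2)] circulant_blocks_first_column[OF C i j] by simp
  finally show "bcirc (tfold n3 F) $$ (i, j) = C $$ (i, j)" .
qed

lemma tensor_of_circulant_blocks:
  assumes C: "circulant_blocks n n3 C" and n3: "0 < n3"
  obtains T where "T \<in> tensors n n n3" "bcirc T = C"
proof (rule that)
  let ?F = "mat (n * n3) n (\<lambda>(i, j). C $$ (i, j))"
  show "tfold n3 ?F \<in> tensors n n n3" by (rule tfold_tensors[OF _ n3]) simp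
  show "bcirc (tfold n3 ?F) = C" by (rule bcirc_tfold[OF C n3]) auto
qed

lemma block_shift_bij:
  "bij_betw (\<lambda>i. (i + n) mod N) {..<N} {..<N :: nat}"
proof (cases "N = 0")
  case False
  have "inj_on (\<lambda>i. (i + n) mod N) {..<N}"
  proof (rule inj_onI)
    fix i j assume ij: "i \<in> {..<N}" "j \<in> {..<N}" and "(i + n) mod N = (j + n) mod N"
    then obtain k l where "i + N * k = j + N * l" by (auto simp: nat_mod_eq_iff)
    then show "i = j" using ij by (metis lessThan_iff mod_less mod_mult_self2)
  qed
  moreover have "(\<lambda>i. (i + n) mod N) ` {..<N} \<subseteq> {..<N}" using False by auto
  ultimately show ?thesis
    by (simp add: bij_betw_def endo_inj_surj)
qed (simp add: bij_betw_def)

lemma circulant_blocks_mult: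
  assumes A: "circulant_blocks n n3 A" and B: "circulant_blocks n n3 B"
  shows "circulant_blocks n n3 (A * B)"
  unfolding circulant_blocks_def
proof (intro conjI allI impI)
  let ?N = "n * n3" and ?s = "\<lambda>i. (i + n) mod (n * n3)"
  have car: "A \<in> carrier_mat ?N ?N" "B \<in> carrier_mat ?N ?N"
    using A B by (auto simp: circulant_blocks_def)
  then show "A * B \<in> carrier_mat ?N ?N" by simp
  have AB: "(A * B) $$ (i, j) = (\<Sum>k<?N. A $$ (i, k) * B $$ (k, j))" if "i < ?N" "j < ?N" for i j
    using that car by (simp add: scalar_prod_def atLeast0LessThan)
  fix i j assume ij: "i < ?N" "j < ?N"
  then have "0 < ?N" by linarith
  then have s: "?s i < ?N" "?s j < ?N" by simp_all
  have "(A * B) $$ (?s i, ?s j) = (\<Sum>k<?N. A $$ (?s i, ?s k) * B $$ (?s k, ?s j))"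
    unfolding AB[OF s] by (rule sum.reindex_bij_betw[OF block_shift_bij, symmetric])
  also have "\<dots> = (\<Sum>k<?N. A $$ (i, k) * B $$ (k, j))"
    using A B ij by (intro sum.cong) (auto simp: circulant_blocks_def)
  finally show "(A * B) $$ (?s i, ?s j) = (A * B) $$ (i, j)" by (simp add: AB[OF ij])
qed

text \<open>
  The t-product only computes the first block column of \<open>bcirc A * bcirc B\<close>. This product is
  again block circulant, so the other columns follow.
\<close>

lemma bcirc_tprod:
  assumes A: "A \<in> tensors n n n3" and B: "B \<in> tensors n n n3" and n3: "0 < n3"
  shows "tprod A B \<in> tensors n n n3" and "bcirc (tprod A B) = bcirc A * bcirc B"
proof -
  note Ac = bcirc_carrier[OF A n3] and Bc = bcirc_carrier[OF B n3]
  let ?F = "bcirc A * tunfold B"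
  have U: "tunfold B \<in> carrier_mat (n * n3) n"
    using tensorsD[OF B] n3 by (simp add: tunfold_def)
  then have F: "?F \<in> carrier_mat (n * n3) n" using Ac by simp
  have prod: "tprod A B = tfold n3 ?F"
    using tensorsD[OF A] by (simp add: tprod_def)
  show "tprod A B \<in> tensors n n n3" unfolding prod by (rule tfold_tensors[OF F n3])
  show "bcirc (tprod A B) = bcirc A * bcirc B"
    unfolding prod
  proof (rule bcirc_tfold[OF _ n3 F])
    show "circulant_blocks n n3 (bcirc A * bcirc B)"
      by (intro circulant_blocks_mult circulant_blocks_bcirc A B n3)
    fix i j assume i: "i < n * n3" and j: "j < n"
    moreover have "n \<le> n * n3" using n3 by simp
    ultimately have "j < n * n3" by linarith
    then show "?F $$ (i, j) = (bcirc A * bcirc B) $$ (i, j)"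
      using i j U Ac Bc tensorsD[OF B] n3
      by (simp add: scalar_prod_def) (auto intro!: sum.cong simp: tunfold_def)
  qed
qed

lemma bcirc_tplus:
  assumes A: "A \<in> tensors n1 n2 n3" and B: "B \<in> tensors n1 n2 n3" and n3: "0 < n3"
  shows "tplus A B \<in> tensors n1 n2 n3" and "bcirc (tplus A B) = bcirc A + bcirc B"
proof -
  show T: "tplus A B \<in> tensors n1 n2 n3"
    using tensorsD(1,2)[OF A] tensorsD(1,2)[OF B]
    by (intro tensorsI) (simp_all add: tplus_def)
  show "bcirc (tplus A B) = bcirc A + bcirc B"
  proof (rule eq_matI)
    fix i j assume "i < dim_row (bcirc A + bcirc B)" "j < dim_col (bcirc A + bcirc B)"
    then have i: "i < n1 * n3" and j: "j < n2 * n3" using bcirc_carrier[OF B n3] by auto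
    let ?k = "(i div n1 + n3 - j div n2) mod n3"
    have k: "?k < n3" using n3 by simp
    have nth: "tplus A B ! ?k = A ! ?k + B ! ?k"
      using k tensorsD(1)[OF A] tensorsD(1)[OF B] by (simp add: tplus_def)
    show "bcirc (tplus A B) $$ (i, j) = (bcirc A + bcirc B) $$ (i, j)"
      using i j carrier_matD[OF bcirc_carrier[OF B n3]] carrier_matD[OF tensorsD(2)[OF B k]]
        mod_less_block[OF i] mod_less_block[OF j]
      by (simp add: bcirc_entry[OF T n3] bcirc_entry[OF A n3] bcirc_entry[OF B n3] nth)
  qed (simp_all add: carrier_matD[OF bcirc_carrier[OF T n3]] carrier_matD[OF bcirc_carrier[OF B n3]])
qed

lemma bcirc_tminus:
  assumes A: "A \<in> tensors n1 n2 n3" and B: "B \<in> tensors n1 n2 n3" and n3: "0 < n3"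
  shows "tminus A B \<in> tensors n1 n2 n3" and "bcirc (tminus A B) = bcirc A - bcirc B"
proof -
  show T: "tminus A B \<in> tensors n1 n2 n3"
    using tensorsD(1,2)[OF A] tensorsD(1,2)[OF B]
    by (intro tensorsI) (simp_all add: tminus_def minus_carrier_mat)
  show "bcirc (tminus A B) = bcirc A - bcirc B"
  proof (rule eq_matI)
    fix i j assume "i < dim_row (bcirc A - bcirc B)" "j < dim_col (bcirc A - bcirc B)"
    then have i: "i < n1 * n3" and j: "j < n2 * n3" using bcirc_carrier[OF B n3] by auto
    let ?k = "(i div n1 + n3 - j div n2) mod n3"
    have k: "?k < n3" using n3 by simp
    have nth: "tminus A B ! ?k = A ! ?k - B ! ?k"
      using k tensorsD(1)[OF A] tensorsD(1)[OF B] by (simp add: tminus_def)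
    show "bcirc (tminus A B) $$ (i, j) = (bcirc A - bcirc B) $$ (i, j)"
      using i j carrier_matD[OF bcirc_carrier[OF B n3]] carrier_matD[OF tensorsD(2)[OF B k]]
        mod_less_block[OF i] mod_less_block[OF j]
      by (simp add: bcirc_entry[OF T n3] bcirc_entry[OF A n3] bcirc_entry[OF B n3] nth)
  qed (simp_all add: carrier_matD[OF bcirc_carrier[OF T n3]] carrier_matD[OF bcirc_carrier[OF B n3]])
qed

lemma bcirc_tscale:
  assumes A: "A \<in> tensors n1 n2 n3" and n3: "0 < n3"
  shows "tscale c A \<in> tensors n1 n2 n3" and "bcirc (tscale c A) = c \<cdot>\<^sub>m bcirc A"
proof -
  show T: "tscale c A \<in> tensors n1 n2 n3"
    using tensorsD(1,2)[OF A] by (intro tensorsI) (simp_all add: tscale_def)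
  show "bcirc (tscale c A) = c \<cdot>\<^sub>m bcirc A"
  proof (rule eq_matI)
    fix i j assume "i < dim_row (c \<cdot>\<^sub>m bcirc A)" "j < dim_col (c \<cdot>\<^sub>m bcirc A)"
    then have i: "i < n1 * n3" and j: "j < n2 * n3" using bcirc_carrier[OF A n3] by auto
    let ?k = "(i div n1 + n3 - j div n2) mod n3"
    have k: "?k < n3" using n3 by simp
    have nth: "tscale c A ! ?k = c \<cdot>\<^sub>m A ! ?k"
      using k tensorsD(1)[OF A] by (simp add: tscale_def)
    show "bcirc (tscale c A) $$ (i, j) = (c \<cdot>\<^sub>m bcirc A) $$ (i, j)"
      using i j carrier_matD[OF bcirc_carrier[OF A n3]] carrier_matD[OF tensorsD(2)[OF A k]]
        mod_less_block[OF i] mod_less_block[OF j]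
      by (simp add: bcirc_entry[OF T n3] bcirc_entry[OF A n3] nth)
  qed (simp_all add: carrier_matD[OF bcirc_carrier[OF T n3]] carrier_matD[OF bcirc_carrier[OF A n3]])
qed

text \<open>
  The slice index is negated modulo \<open>n3\<close>; the outer \<open>mod\<close> keeps the first slice in place.
\<close>

lemma ttranspose_nth:
  assumes A: "A \<in> tensors n1 n2 n3" and k: "k < n3"
  shows "ttranspose A ! k = transpose_mat (A ! ((n3 - k) mod n3))"
proof (cases k)
  case 0
  then show ?thesis using k tensorsD(1)[OF A] by (cases A) (auto simp: ttranspose_def)
next
  case (Suc l)
  obtain S R where SR: "A = S # R" "n3 = Suc (length R)"
    using k tensorsD(1)[OF A] by (cases A) auto
  have l: "l < length R" using k Suc SR by simp
  have idx: "(n3 - k) mod n3 = Suc (length R - Suc l)"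
    unfolding SR(2) Suc using l by simp
  have "ttranspose A ! k = transpose_mat (R ! (length R - Suc l))"
    unfolding ttranspose_def SR(1) Suc using l by (simp add: rev_nth)
  then show ?thesis unfolding idx SR(1) by simp
qed

lemma bcirc_ttranspose:
  assumes A: "A \<in> tensors n1 n2 n3" and n3: "0 < n3"
  shows "ttranspose A \<in> tensors n2 n1 n3" and "bcirc (ttranspose A) = transpose_mat (bcirc A)"
proof -
  have len: "length (ttranspose A) = n3"
    using n3 tensorsD(1)[OF A] by (cases A) (auto simp: ttranspose_def)
  show T: "ttranspose A \<in> tensors n2 n1 n3"
    by (rule tensorsI[OF len])
      (simp add: ttranspose_nth[OF A] tensorsD(2)[OF A] n3)
  show "bcirc (ttranspose A) = transpose_mat (bcirc A)"
  proof (rule eq_matI)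
    fix i j assume "i < dim_row (transpose_mat (bcirc A))" "j < dim_col (transpose_mat (bcirc A))"
    then have i: "i < n2 * n3" and j: "j < n1 * n3" using bcirc_carrier[OF A n3] by auto
    let ?k = "(i div n2 + n3 - j div n1) mod n3" and ?l = "(j div n1 + n3 - i div n2) mod n3"
    have k: "?k < n3" and l: "?l < n3" using n3 by auto
    have kl: "(n3 - ?k) mod n3 = ?l"
    proof -
      define a b where "a = i div n2" and "b = j div n1"
      have ab: "a < n3" "b < n3" using div_less_blocks i j by (auto simp: a_def b_def)
      then show ?thesis unfolding a_def b_def by (rule mod_minus_diff)
    qed
    have "bcirc (ttranspose A) $$ (i, j) = (A ! ?l) $$ (j mod n1, i mod n2)"
      using mod_less_block[OF i] mod_less_block[OF j] tensorsD(2)[OF A l]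
      unfolding bcirc_entry[OF T n3 i j] ttranspose_nth[OF A k] kl by simp
    also have "\<dots> = transpose_mat (bcirc A) $$ (i, j)"
      using i j carrier_matD[OF bcirc_carrier[OF A n3]] bcirc_entry[OF A n3 j i] by simp
    finally show "bcirc (ttranspose A) $$ (i, j) = transpose_mat (bcirc A) $$ (i, j)" .
  qed (simp_all add: carrier_matD[OF bcirc_carrier[OF T n3]] carrier_matD[OF bcirc_carrier[OF A n3]])
qed

lemma tsymmetric_iff:
  assumes A: "A \<in> tensors n n n3" and n3: "0 < n3"
  shows "tsymmetric A \<longleftrightarrow> transpose_mat (bcirc A) = bcirc A"
proof
  assume "tsymmetric A"
  then have "ttranspose A = A" by (simp only: tsymmetric_def)
  then show "transpose_mat (bcirc A) = bcirc A"
    by (simp only: bcirc_ttranspose(2)[OF A n3, symmetric])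
next
  assume "transpose_mat (bcirc A) = bcirc A"
  then have "bcirc (ttranspose A) = bcirc A"
    by (simp only: bcirc_ttranspose(2)[OF A n3])
  then show "tsymmetric A"
    unfolding tsymmetric_def by (rule bcirc_inject[OF bcirc_ttranspose(1)[OF A n3] A n3])
qed

lemma sum_blocks:
  fixes f :: "nat \<Rightarrow> 'a :: comm_monoid_add"
  shows "(\<Sum>k<m. \<Sum>i<n. f (k * n + i)) = (\<Sum>l<n * m. f l)"
proof -
  have "(\<Sum>k<m. \<Sum>i<n. f (k * n + i)) = (\<Sum>k<m. sum f {k * n..<k * n + n})"
  proof (rule sum.cong[OF refl])
    fix k
    show "(\<Sum>i<n. f (k * n + i)) = sum f {k * n..<k * n + n}"
      using sum.atLeastLessThan_shift_bounds[of f 0 "k * n" n]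
      by (simp add: atLeast0LessThan comp_def add.commute[of n])
  qed
  then show ?thesis by (simp add: sum.nat_group mult.commute)
qed

text \<open>
  A column tensor \<open>X\<close> unfolds to a vector \<open>x\<close>, and \<open>A * X\<close> unfolds to \<open>bcirc A\<close> applied to \<open>x\<close>.
\<close>

lemma tinner_tprod_tfold:
  assumes A: "A \<in> tensors n n n3" and n3: "0 < n3" and x: "x \<in> carrier_vec (n * n3)"
  defines "X \<equiv> tfold n3 (mat (n * n3) 1 (\<lambda>(i, j). x $ i))"
  shows "X \<in> tensors n 1 n3"
    and "tinner X (tprod A X) = scalar_prod x (bcirc A *\<^sub>v x)"
proof -
  let ?F = "mat (n * n3) 1 (\<lambda>(i, j). x $ i)"
  have F: "?F \<in> carrier_mat (n * n3) 1" by simp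
  have one: "0 < (1 :: nat)" by simp
  show X: "X \<in> tensors n 1 n3" unfolding X_def by (rule tfold_tensors[OF F n3])
  have Xe: "(X ! k) $$ (i, 0) = x $ (k * n + i)" if "k < n3" "i < n" for k i
  proof -
    have "Suc k * n \<le> n3 * n" using that by (intro mult_right_mono) auto
    then have "k * n + i < n * n3" using that by (simp add: mult.commute)
    then show ?thesis unfolding X_def using tfold_entry[OF F that one] by simp
  qed
  have U: "tunfold X = ?F"
  proof (rule eq_matI)
    fix i j assume "i < dim_row ?F" "j < dim_col ?F"
    then have i: "i < n * n3" and j: "j = 0" by auto
    have "tunfold X $$ (i, 0) = bcirc X $$ (i, 0)"
      using tensorsD[OF X] i n3 by (simp add: tunfold_def)
    also have "\<dots> = x $ i"
      using div_less_blocks[OF i] mod_less_block[OF i] i n3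
      by (simp add: bcirc_entry[OF X n3] Xe)
    finally show "tunfold X $$ (i, j) = ?F $$ (i, j)" using i j by simp
  qed (use tensorsD[OF X] n3 in \<open>auto simp: tunfold_def\<close>)
  let ?y = "bcirc A *\<^sub>v x"
  note Ac = bcirc_carrier[OF A n3]
  have P: "bcirc A * ?F \<in> carrier_mat (n * n3) 1" using Ac by simp
  have Ye: "(tprod A X ! k) $$ (i, 0) = ?y $ (k * n + i)" if "k < n3" "i < n" for k i
  proof -
    have "Suc k * n \<le> n3 * n" using that by (intro mult_right_mono) auto
    then have less: "k * n + i < n * n3" using that by (simp add: mult.commute)
    have "(tprod A X ! k) $$ (i, 0) = (bcirc A * ?F) $$ (k * n + i, 0)"
      unfolding tprod_def U tensorsD(1)[OF A] by (rule tfold_entry[OF P that one])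
    also have "\<dots> = ?y $ (k * n + i)"
      using less Ac x by (auto simp: scalar_prod_def intro!: sum.cong)
    finally show ?thesis .
  qed
  have dims: "dim_row (X ! k) = n" "dim_col (X ! k) = 1" if "k < n3" for k
    using tensorsD(2)[OF X that] by auto
  have "tinner X (tprod A X) = (\<Sum>k<n3. \<Sum>i<n. x $ (k * n + i) * ?y $ (k * n + i))"
    unfolding tinner_def tensorsD(1)[OF X] by (intro sum.cong) (simp_all add: dims Xe Ye)
  also have "\<dots> = (\<Sum>l<n * n3. x $ l * ?y $ l)"
    by (rule sum_blocks)
  also have "\<dots> = scalar_prod x ?y"
    using Ac by (simp add: scalar_prod_def atLeast0LessThan)
  finally show "tinner X (tprod A X) = scalar_prod x ?y" .
qed

lemma tpsd_iff:
  assumes A: "A \<in> tensors n n n3" and n3: "0 < n3"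
  shows "tpsd n n3 A \<longleftrightarrow> transpose_mat (bcirc A) = bcirc A \<and>
    (\<forall>x \<in> carrier_vec (n * n3). 0 \<le> scalar_prod x (bcirc A *\<^sub>v x))"
proof -
  let ?fold = "\<lambda>x. tfold n3 (mat (n * n3) 1 (\<lambda>(i, j). x $ i))"
  note q = tinner_tprod_tfold[OF A n3]
  have "0 \<le> scalar_prod x (bcirc A *\<^sub>v x)"
    if "tpsd n n3 A" and x: "x \<in> carrier_vec (n * n3)" for x
  proof (cases "?fold x = tzero n 1 n3")
    case True
    have "tinner (?fold x) Y = 0" for Y
      unfolding True by (simp add: tinner_def tzero_def)
    then show ?thesis using q(2)[OF x] by simp
  next
    case False
    then have "0 \<le> tinner (?fold x) (tprod A (?fold x))"
      using that(1) q(1)[OF x] unfolding tpsd_def by blast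
    then show ?thesis by (simp only: q(2)[OF x])
  qed
  moreover have "0 \<le> tinner X (tprod A X)"
    if psd: "\<forall>x \<in> carrier_vec (n * n3). 0 \<le> scalar_prod x (bcirc A *\<^sub>v x)"
      and X: "X \<in> tensors n 1 n3" for X
  proof -
    let ?x = "col (tunfold X) 0"
    have U: "tunfold X \<in> carrier_mat (n * n3) 1"
      using tensorsD[OF X] n3 by (simp add: tunfold_def)
    have x: "?x \<in> carrier_vec (n * n3)"
      using col_dim[of "tunfold X" 0] unfolding carrier_matD[OF U] .
    have "mat (n * n3) 1 (\<lambda>(i, j). ?x $ i) = tunfold X"
      using U by (intro eq_matI) auto
    then have "?fold ?x = X" by (simp add: tfold_tunfold[OF X n3])
    then show ?thesis using q(2)[OF x] psd x by simp
  qed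
  ultimately show ?thesis
    using A by (auto simp: tpsd_def tsymmetric_iff[OF A n3])
qed

section \<open>Powers of positive semidefinite tensors\<close>

text \<open>
  If \<open>V\<close> is \<open>U\<close> with its rows shifted by one block, then \<open>V diag(d) V\<^sup>T\<close> is the matrix with rows and
  columns shifted, which is the same matrix. So \<open>V\<close> is another eigenbasis, and as \<open>f\<close> of the matrix
  is the same in both bases, it is shift-invariant too.
\<close>

lemma circulant_blocks_spectral_mat:
  assumes U: "U \<in> carrier_mat (n * n3) (n * n3)" "U * transpose_mat U = 1\<^sub>m (n * n3)"
    and C: "circulant_blocks n n3 (spectral_mat (n * n3) U d)"
  shows "circulant_blocks n n3 (spectral_mat (n * n3) U (\<lambda>i. f (d i)))"
proof -
  let ?N = "n * n3" and ?s = "\<lambda>i. (i + n) mod (n * n3)"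
  define V where "V = mat ?N ?N (\<lambda>(i, j). U $$ (?s i, j))"
  have V: "V \<in> carrier_mat ?N ?N" by (simp add: V_def)
  have s: "?s i < ?N" if "i < ?N" for i
  proof -
    have "0 < ?N" using that by linarith
    then show ?thesis by simp
  qed
  have permute: "spectral_mat ?N V e $$ (i, j) = spectral_mat ?N U e $$ (?s i, ?s j)"
    if "i < ?N" "j < ?N" for e i j
    unfolding spectral_mat_entry[OF V that] spectral_mat_entry[OF U(1) s[OF that(1)] s[OF that(2)]]
    by (intro sum.cong) (simp_all add: V_def that)
  have VV: "V * transpose_mat V = 1\<^sub>m ?N"
  proof (rule eq_matI)
    fix i j assume "i < dim_row (1\<^sub>m ?N :: real mat)" "j < dim_col (1\<^sub>m ?N :: real mat)"
    then have ij: "i < ?N" "j < ?N" by auto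
    have "?s i = ?s j \<longleftrightarrow> i = j"
      using block_shift_bij[of n ?N] ij by (auto simp: bij_betw_def inj_on_def)
    have "(V * transpose_mat V) $$ (i, j) = (U * transpose_mat U) $$ (?s i, ?s j)"
      using ij s U(1) by (simp add: scalar_prod_def V_def)
    also have "\<dots> = (1\<^sub>m ?N :: real mat) $$ (i, j)"
      unfolding U(2) using ij s \<open>?s i = ?s j \<longleftrightarrow> i = j\<close> by simp
    finally show "(V * transpose_mat V) $$ (i, j) = (1\<^sub>m ?N :: real mat) $$ (i, j)" .
  qed (use V in auto)
  have eq: "spectral_mat ?N V d = spectral_mat ?N U d"
  proof (rule eq_matI)
    note c = carrier_matD[OF spectral_mat_carrier[OF U(1), of d]]
    fix i j assume "i < dim_row (spectral_mat ?N U d)" "j < dim_col (spectral_mat ?N U d)"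
    then have ij: "i < ?N" "j < ?N" unfolding c .
    show "spectral_mat ?N V d $$ (i, j) = spectral_mat ?N U d $$ (i, j)"
      using C ij unfolding permute[OF ij] circulant_blocks_def by blast
  qed (simp_all add: carrier_matD[OF spectral_mat_carrier[OF U(1)]]
      carrier_matD[OF spectral_mat_carrier[OF V]])
  have "spectral_mat ?N V (\<lambda>i. f (d i)) = spectral_mat ?N U (\<lambda>i. f (d i))"
    by (rule spectral_mat_unique[OF V VV U eq])
  then show ?thesis
    unfolding circulant_blocks_def using permute spectral_mat_carrier[OF U(1)] by metis
qed

text \<open>
  Both definite descriptions behind a tensor power are resolved here: the matrix power by
  independence of the eigenbasis, the tensor by block circulance and injectivity of \<open>bcirc\<close>.
\<close>

lemma tpower_spectral_mat:
  assumes A: "A \<in> tensors n n n3" and n3: "0 < n3"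
    and U: "U \<in> carrier_mat (n * n3) (n * n3)" "U * transpose_mat U = 1\<^sub>m (n * n3)"
    and A_eq: "bcirc A = spectral_mat (n * n3) U d" and d: "\<And>i. i < n * n3 \<Longrightarrow> 0 \<le> d i"
  shows "tpower A r \<in> tensors n n n3"
    and "bcirc (tpower A r) = spectral_mat (n * n3) U (\<lambda>i. d i powr r)"
proof -
  have pow: "psd_power (bcirc A) r = spectral_mat (n * n3) U (\<lambda>i. d i powr r)"
    unfolding A_eq by (rule psd_power_spectral_mat[OF U d])
  have "circulant_blocks n n3 (spectral_mat (n * n3) U (\<lambda>i. d i powr r))"
    by (rule circulant_blocks_spectral_mat[OF U])
      (use circulant_blocks_bcirc[OF A n3] A_eq in simp)
  then obtain T where T: "T \<in> tensors n n n3" "bcirc T = psd_power (bcirc A) r"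
    unfolding pow using tensor_of_circulant_blocks n3 by metis
  have "tpower A r = T"
    unfolding tpower_def tensorsD(1)[OF A] tensorsD(3,4)[OF A n3]
  proof (rule the_equality)
    show "T \<in> tensors n n n3 \<and> bcirc T = psd_power (bcirc A) r"
      by (intro conjI T)
    fix S assume S: "S \<in> tensors n n n3 \<and> bcirc S = psd_power (bcirc A) r"
    show "S = T"
      by (rule bcirc_inject[OF conjunct1[OF S] T(1) n3]) (simp only: S T(2))
  qed
  then show "tpower A r \<in> tensors n n n3"
    and "bcirc (tpower A r) = spectral_mat (n * n3) U (\<lambda>i. d i powr r)"
    by (simp_all only: T pow)
qed

section \<open>Young's inequality for tensors\<close>

theorem theorem3p4:
  fixes n n3 :: nat and A B :: tensor
  assumes "0 < n" and "0 < n3"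
    and "A \<in> tensors n n n3" and "B \<in> tensors n n n3"
    and "tpsd n n3 A" and "tpsd n n3 B"
    and "tprod A B = tprod B A"
    and "tpsd n n3 (tprod A B)"
  shows "\<forall>p q :: real. p > 1 \<longrightarrow> q > 1 \<longrightarrow> 1 / p + 1 / q = 1 \<longrightarrow>
    tle n n3 (tprod A B) (tplus (tscale (1 / p) (tpower A p)) (tscale (1 / q) (tpower B q)))"
proof (intro allI impI)
  fix p q :: real assume p: "p > 1" and q: "q > 1" and pq: "1 / p + 1 / q = 1"
  note n3 = assms(2) and A = assms(3) and B = assms(4)
  let ?N = "n * n3"
  obtain U d where U: "U \<in> carrier_mat ?N ?N" "U * transpose_mat U = 1\<^sub>m ?N"
    and A_eq: "bcirc A = spectral_mat ?N U d" and d: "\<And>i. i < ?N \<Longrightarrow> 0 \<le> d i"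
    using psd_spectral_decomposition[OF bcirc_carrier[OF A n3]] assms(5)
    unfolding tpsd_iff[OF A n3] by blast
  obtain V e where V: "V \<in> carrier_mat ?N ?N" "V * transpose_mat V = 1\<^sub>m ?N"
    and B_eq: "bcirc B = spectral_mat ?N V e" and e: "\<And>i. i < ?N \<Longrightarrow> 0 \<le> e i"
    using psd_spectral_decomposition[OF bcirc_carrier[OF B n3]] assms(6)
    unfolding tpsd_iff[OF B n3] by blast
  note Ap = tpower_spectral_mat[OF A n3 U A_eq d, of p]
  note Bq = tpower_spectral_mat[OF B n3 V B_eq e, of q]
  define Y where "Y = tplus (tscale (1 / p) (tpower A p)) (tscale (1 / q) (tpower B q))"
  note sA = bcirc_tscale[OF Ap(1) n3, of "1 / p"] and sB = bcirc_tscale[OF Bq(1) n3, of "1 / q"]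
  have Y: "Y \<in> tensors n n n3"
    unfolding Y_def by (rule bcirc_tplus(1)[OF sA(1) sB(1) n3])
  have Y_eq: "bcirc Y = spectral_mat ?N U (\<lambda>i. 1 / p * d i powr p)
      + spectral_mat ?N V (\<lambda>i. 1 / q * e i powr q)"
    using bcirc_tplus(2)[OF sA(1) sB(1) n3]
    by (simp only: Y_def sA(2) sB(2) Ap(2) Bq(2) smult_spectral_mat[OF U(1)] smult_spectral_mat[OF V(1)])
  have Y_sym: "transpose_mat (bcirc Y) = bcirc Y"
    unfolding Y_eq
    by (subst transpose_add[of _ ?N ?N]) (simp_all add: U(1) V(1) transpose_spectral_mat)
  note P = bcirc_tprod[OF A B n3]
  have P_sym: "transpose_mat (bcirc (tprod A B)) = bcirc (tprod A B)"
    using assms(8) unfolding tpsd_iff[OF P(1) n3] by blast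
  have comm: "spectral_mat ?N U d * spectral_mat ?N V e = spectral_mat ?N V e * spectral_mat ?N U d"
    using assms(7) P(2) bcirc_tprod(2)[OF B A n3] unfolding A_eq B_eq by simp
  note D = bcirc_tminus[OF Y P(1) n3]
  have "tpsd n n3 (tminus Y (tprod A B))"
    unfolding tpsd_iff[OF D(1) n3]
  proof (intro conjI ballI)
    show "transpose_mat (bcirc (tminus Y (tprod A B))) = bcirc (tminus Y (tprod A B))"
      unfolding D(2)
      by (subst transpose_minus[of _ ?N ?N])
        (simp_all add: bcirc_carrier[OF Y n3] bcirc_carrier[OF P(1) n3] Y_sym P_sym)
    fix x :: "real vec" assume x: "x \<in> carrier_vec ?N"
    have "d i * e j \<le> 1 / p * d i powr p + 1 / q * e j powr q" if "i < ?N" "j < ?N" for i j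
      using Youngs_inequality[OF p q pq d[OF that(1)] e[OF that(2)]] by simp
    then show "0 \<le> scalar_prod x (bcirc (tminus Y (tprod A B)) *\<^sub>v x)"
      unfolding D(2) Y_eq P(2) A_eq B_eq
      by (intro commuting_product_bound[OF U V comm _ x, where f = "\<lambda>t. 1 / p * t powr p"
        and g = "\<lambda>t. 1 / q * t powr q"])
  qed
  then show "tle n n3 (tprod A B) (tplus (tscale (1 / p) (tpower A p)) (tscale (1 / q) (tpower B q)))"
    unfolding tle_def Y_def[symmetric]
    using Y P(1) Y_sym P_sym tsymmetric_iff[OF Y n3] tsymmetric_iff[OF P(1) n3] by blast
qed

end
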